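(* Let $R$ be a ring. Then the following four conditions are equivalent: (1) $R$ is $\Delta U$. (2) $T_n(R)$ is $\Delta U$ for all $n\in\mathbb{N}$. (3) $T_n(R)$ is $\Delta U$ for some $n\in\mathbb{N}$. (4) $T_n(R)$ is $W\Delta U$ for some $n\ge 2$.
   Context: Rings are associative with identity, not necessarily commutative; $\mathbb{N}=\{1,2,\dots\}$. $T_n(R)$ is the ring of $n\times n$ upper triangular matrices over $R$. $U(S)$ is the group of units of a ring $S$. $\Delta(S)=\{r\in S : r+u\in U(S)\text{ for all }u\in U(S)\}$; equivalently $\Delta(S)=J(T)$, where $T$ is the subring of $S$ generated by $U(S)$ and $J$ denotes the Jacobson radical. $S$ is $\Delta U$ if $U(S)=1+\Delta(S)$. $S$ is $W\Delta U$ if $U(S)=\pm 1+\Delta(S)$, i.e. every unit of $S$ has the form $1+d$ or $-1+d$ with $d\in\Delta(S)$. *)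

theory Defs
  imports "HOL-Algebra.Ring" "Jordan_Normal_Form.Matrix"
begin

definition Delta :: "('a, 'm) ring_scheme \<Rightarrow> 'a set" where
  "Delta S = {r \<in> carrier S. \<forall>u \<in> Units S. r \<oplus>\<^bsub>S\<^esub> u \<in> Units S}"

definition delta_U :: "('a, 'm) ring_scheme \<Rightarrow> bool" where
  "delta_U S \<longleftrightarrow> Units S = {\<one>\<^bsub>S\<^esub> \<oplus>\<^bsub>S\<^esub> d | d. d \<in> Delta S}"

definition weak_delta_U :: "('a, 'm) ring_scheme \<Rightarrow> bool" where
  "weak_delta_U S \<longleftrightarrow>
     Units S = {\<one>\<^bsub>S\<^esub> \<oplus>\<^bsub>S\<^esub> d | d. d \<in> Delta S}
             \<union> {(\<ominus>\<^bsub>S\<^esub> \<one>\<^bsub>S\<^esub>) \<oplus>\<^bsub>S\<^esub> d | d. d \<in> Delta S}"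

text \<open>
  The arithmetic on \<^typ>\<open>'a mat\<close> is tied to type classes, so only the matrix type itself
  is used; entries are combined with the operations of \<open>R\<close>. Rows and columns are
  indexed by \<open>0, \<dots>, n - 1\<close>.
\<close>

definition upper_triangular_ring :: "('a, 'm) ring_scheme \<Rightarrow> nat \<Rightarrow> 'a mat ring" where
  "upper_triangular_ring R n =
    \<lparr>carrier = {A \<in> carrier_mat n n.
        (\<forall>i<n. \<forall>j<n. A $$ (i, j) \<in> carrier R) \<and>
        (\<forall>i<n. \<forall>j<i. A $$ (i, j) = \<zero>\<^bsub>R\<^esub>)},
     mult = (\<lambda>A B. mat n n (\<lambda>(i, j).
        \<Oplus>\<^bsub>R\<^esub>k\<in>{..<n}. A $$ (i, k) \<otimes>\<^bsub>R\<^esub> B $$ (k, j))),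
     one = mat n n (\<lambda>(i, j). if i = j then \<one>\<^bsub>R\<^esub> else \<zero>\<^bsub>R\<^esub>),
     zero = mat n n (\<lambda>(i, j). \<zero>\<^bsub>R\<^esub>),
     add = (\<lambda>A B. mat n n (\<lambda>(i, j). A $$ (i, j) \<oplus>\<^bsub>R\<^esub> B $$ (i, j)))\<rparr>"

end

(*
  A triangular matrix is a unit of T_n(R) iff its diagonal entries are units of R (solve for a left
  inverse row by row, and apply the same to that inverse). Hence Delta(T_n(R)) consists of the
  matrices with diagonal entries in Delta(R), and the Delta-U property passes between R and T_n(R).
  For the weak property with n >= 2, apply it to diag(1, u, 1, ..., 1): either the second entry
  gives u - 1 in Delta(R), or the first two give 2 and u + 1 in Delta(R), and Delta(R) is closed
  under differences.
*)

theory Submission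
  imports Defs "Jordan_Normal_Form.Missing_Ring"
begin

subsection \<open>The set Delta of a ring\<close>

context ring
begin

lemma Units_minus_closed:
  assumes "u \<in> Units R"
  shows "\<ominus> u \<in> Units R"
proof -
  obtain v where v: "v \<in> carrier R" "v \<otimes> u = \<one>" "u \<otimes> v = \<one>"
    using assms by (auto simp: Units_def)
  have "u \<in> carrier R" using assms by auto
  with v show ?thesis
    by (auto simp: Units_def l_minus r_minus intro!: bexI[of _ "\<ominus> v"])
qed

lemma Delta_closed: "d \<in> Delta R \<Longrightarrow> d \<in> carrier R"
  by (simp add: Delta_def)

lemma Delta_add_Unit: "d \<in> Delta R \<Longrightarrow> u \<in> Units R \<Longrightarrow> d \<oplus> u \<in> Units R"
  by (simp add: Delta_def)

text \<open>For a unit \<open>u\<close>, regroup \<open>d - e + u\<close> as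
  \<open>d - (e - u)\<close>. Since \<open>-u\<close> is a unit, so is \<open>e - u\<close>, hence
  so is its negative, and adding \<open>d\<close> preserves this.\<close>

lemma Delta_minus_closed:
  assumes "d \<in> Delta R" "e \<in> Delta R"
  shows "d \<ominus> e \<in> Delta R"
  unfolding Delta_def
proof (intro CollectI conjI ballI)
  note [simp] = assms[THEN Delta_closed]
  show "d \<ominus> e \<in> carrier R" by simp
  fix u assume u: "u \<in> Units R"
  then have [simp]: "u \<in> carrier R" by auto
  have "d \<oplus> \<ominus> (e \<oplus> \<ominus> u) \<in> Units R"
    using assms u by (intro Delta_add_Unit Units_minus_closed)
  also have "d \<oplus> \<ominus> (e \<oplus> \<ominus> u) = d \<ominus> e \<oplus> u"
    by (simp add: minus_add a_minus_def a_assoc)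
  finally show "d \<ominus> e \<oplus> u \<in> Units R" .
qed

text \<open>Trades membership in the coset \<open>a + Delta R\<close> for a condition on a
  difference, which can later be read entry by entry.\<close>

lemma add_Delta_iff:
  assumes "u \<in> carrier R" "a \<in> carrier R"
  shows "u \<in> {a \<oplus> d | d. d \<in> Delta R} \<longleftrightarrow> u \<ominus> a \<in> Delta R"
proof
  assume "u \<in> {a \<oplus> d | d. d \<in> Delta R}"
  then obtain d where d: "u = a \<oplus> d" "d \<in> Delta R" by blast
  have "u \<ominus> a = d"
    using assms Delta_closed[OF d(2)] by (simp add: d(1) a_minus_def a_comm[of a d] a_assoc r_neg)
  with d show "u \<ominus> a \<in> Delta R" by simp
next
  assume *: "u \<ominus> a \<in> Delta R"
  have "u = a \<oplus> (u \<ominus> a)"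
    using assms by (simp add: a_minus_def a_comm[of u] r_neg2)
  with * show "u \<in> {a \<oplus> d | d. d \<in> Delta R}" by blast
qed

text \<open>One inclusion in the equations defining \<open>delta_U\<close> and
  \<open>weak_delta_U\<close> is automatic in every ring; both characterisations below therefore
  test only the other one.\<close>

lemma Unit_add_Delta_subset:
  assumes "a \<in> Units R"
  shows "{a \<oplus> d | d. d \<in> Delta R} \<subseteq> Units R"
proof clarify
  fix d assume d: "d \<in> Delta R"
  have "d \<oplus> a \<in> Units R" using d assms by (rule Delta_add_Unit)
  then show "a \<oplus> d \<in> Units R"
    using Delta_closed[OF d] Units_closed[OF assms] by (simp add: a_comm)
qed

lemma delta_U_iff: "delta_U R \<longleftrightarrow> (\<forall>u \<in> Units R. u \<ominus> \<one> \<in> Delta R)"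
proof -
  have "delta_U R \<longleftrightarrow> (\<forall>u \<in> Units R. u \<in> {\<one> \<oplus> d | d. d \<in> Delta R})"
    using Unit_add_Delta_subset[OF Units_one_closed] unfolding delta_U_def by blast
  then show ?thesis
    by (simp only: add_Delta_iff Units_closed one_closed cong: ball_cong)
qed

text \<open>The cosets of \<open>\<one>\<close> and of its negative both consist of units. For the
  second, \<open>add_Delta_iff\<close> yields \<open>u \<ominus> (\<ominus> \<one>)\<close>, which
  is \<open>u \<oplus> \<one>\<close>.\<close>

lemma weak_delta_U_iff:
  "weak_delta_U R \<longleftrightarrow> (\<forall>u \<in> Units R. u \<ominus> \<one> \<in> Delta R \<or> u \<oplus> \<one> \<in> Delta R)"
proof -
  have "weak_delta_U R \<longleftrightarrow>
      (\<forall>u \<in> Units R. u \<in> {\<one> \<oplus> d | d. d \<in> Delta R} \<or> u \<in> {\<ominus> \<one> \<oplus> d | d. d \<in> Delta R})"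
    using Unit_add_Delta_subset[OF Units_one_closed]
      Unit_add_Delta_subset[OF Units_minus_closed[OF Units_one_closed]]
    unfolding weak_delta_U_def by blast
  also have "\<dots> \<longleftrightarrow> (\<forall>u \<in> Units R. u \<ominus> \<one> \<in> Delta R \<or> u \<ominus> (\<ominus> \<one>) \<in> Delta R)"
    by (simp only: add_Delta_iff Units_closed one_closed a_inv_closed cong: ball_cong)
  finally show ?thesis
    by (simp add: a_minus_def)
qed

end

subsection \<open>The ring of upper triangular matrices\<close>

abbreviation diag_mat_ring :: "('a, 'm) ring_scheme \<Rightarrow> nat \<Rightarrow> (nat \<Rightarrow> 'a) \<Rightarrow> 'a mat" where
  "diag_mat_ring R n f \<equiv> mat n n (\<lambda>(i, j). if i = j then f i else \<zero>\<^bsub>R\<^esub>)"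

context ring
begin

abbreviation UT :: "nat \<Rightarrow> 'a mat ring" where
  "UT n \<equiv> upper_triangular_ring R n"

lemma UT_carrier_iff:
  "A \<in> carrier (UT n) \<longleftrightarrow> A \<in> carrier_mat n n
     \<and> (\<forall>i<n. \<forall>j<n. A $$ (i, j) \<in> carrier R) \<and> (\<forall>i<n. \<forall>j<i. A $$ (i, j) = \<zero>)"
  by (simp add: upper_triangular_ring_def)

lemma UT_entry_closed:
  "A \<in> carrier (UT n) \<Longrightarrow> i < n \<Longrightarrow> j < n \<Longrightarrow> A $$ (i, j) \<in> carrier R"
  by (simp add: UT_carrier_iff)

lemma UT_entry_zero: "A \<in> carrier (UT n) \<Longrightarrow> i < n \<Longrightarrow> j < i \<Longrightarrow> A $$ (i, j) = \<zero>"
  by (simp add: UT_carrier_iff)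

lemma UT_eqI:
  assumes "A \<in> carrier (UT n)" "B \<in> carrier (UT n)"
    and "\<And>i j. i < n \<Longrightarrow> j < n \<Longrightarrow> A $$ (i, j) = B $$ (i, j)"
  shows "A = B"
  using assms by (intro eq_matI) (auto simp: UT_carrier_iff)

lemma UT_mult_entry:
  "i < n \<Longrightarrow> j < n \<Longrightarrow>
    (A \<otimes>\<^bsub>UT n\<^esub> B) $$ (i, j) = (\<Oplus>k\<in>{..<n}. A $$ (i, k) \<otimes> B $$ (k, j))"
  by (simp add: upper_triangular_ring_def)

lemma UT_add_entry:
  "i < n \<Longrightarrow> j < n \<Longrightarrow> (A \<oplus>\<^bsub>UT n\<^esub> B) $$ (i, j) = A $$ (i, j) \<oplus> B $$ (i, j)"
  by (simp add: upper_triangular_ring_def)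

lemma UT_zero_entry: "i < n \<Longrightarrow> j < n \<Longrightarrow> \<zero>\<^bsub>UT n\<^esub> $$ (i, j) = \<zero>"
  by (simp add: upper_triangular_ring_def)

lemma UT_one_entry:
  "i < n \<Longrightarrow> j < n \<Longrightarrow> \<one>\<^bsub>UT n\<^esub> $$ (i, j) = (if i = j then \<one> else \<zero>)"
  by (simp add: upper_triangular_ring_def)

section \<open>Ring axioms for triangular matrices\<close>

lemma UT_mult_closed:
  assumes A: "A \<in> carrier (UT n)" and B: "B \<in> carrier (UT n)"
  shows "A \<otimes>\<^bsub>UT n\<^esub> B \<in> carrier (UT n)"
proof -
  have "(\<Oplus>k\<in>{..<n}. A $$ (i, k) \<otimes> B $$ (k, j)) = \<zero>" if "i < n" "j < i" for i j
  proof (rule add.finprod_one_eqI)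
    fix k assume "k \<in> {..<n}"
    \<comment> \<open>If \<open>k < i\<close>, the factor from \<open>A\<close> lies below the
      diagonal; otherwise \<open>j < i \<le> k\<close> and the factor from \<open>B\<close>
      does.\<close>
    then show "A $$ (i, k) \<otimes> B $$ (k, j) = \<zero>"
      using that A B by (cases "k < i") (auto simp: UT_entry_zero UT_entry_closed)
  qed
  moreover have "(\<Oplus>k\<in>{..<n}. A $$ (i, k) \<otimes> B $$ (k, j)) \<in> carrier R" if "i < n" "j < n" for i j
    using that A B by (auto intro!: finsum_closed simp: UT_entry_closed)
  moreover have "A \<otimes>\<^bsub>UT n\<^esub> B \<in> carrier_mat n n"
    by (simp add: upper_triangular_ring_def)
  ultimately show ?thesis
    unfolding UT_carrier_iff by (auto simp: UT_mult_entry)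
qed

lemma UT_add_closed:
  "A \<in> carrier (UT n) \<Longrightarrow> B \<in> carrier (UT n) \<Longrightarrow> A \<oplus>\<^bsub>UT n\<^esub> B \<in> carrier (UT n)"
  by (auto simp: upper_triangular_ring_def)

lemma diag_mat_ring_closed:
  "(\<And>i. i < n \<Longrightarrow> f i \<in> carrier R) \<Longrightarrow> diag_mat_ring R n f \<in> carrier (UT n)"
  by (auto simp: UT_carrier_iff)

lemma UT_zero_closed: "\<zero>\<^bsub>UT n\<^esub> \<in> carrier (UT n)"
  by (auto simp: upper_triangular_ring_def)

lemma UT_one_closed: "\<one>\<^bsub>UT n\<^esub> \<in> carrier (UT n)"
  by (auto simp: upper_triangular_ring_def)

text \<open>Both sides expand by distributivity to the double sum of \<open>?t\<close>, with the two
  finite summations in opposite orders.\<close>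

lemma UT_mult_assoc:
  assumes A: "A \<in> carrier (UT n)" and B: "B \<in> carrier (UT n)" and C: "C \<in> carrier (UT n)"
  shows "(A \<otimes>\<^bsub>UT n\<^esub> B) \<otimes>\<^bsub>UT n\<^esub> C = A \<otimes>\<^bsub>UT n\<^esub> (B \<otimes>\<^bsub>UT n\<^esub> C)"
proof (rule UT_eqI)
  fix i j assume ij: "i < n" "j < n"
  let ?t = "\<lambda>k l. A $$ (i, l) \<otimes> B $$ (l, k) \<otimes> C $$ (k, j)"
  have "((A \<otimes>\<^bsub>UT n\<^esub> B) \<otimes>\<^bsub>UT n\<^esub> C) $$ (i, j)
      = (\<Oplus>k\<in>{..<n}. (\<Oplus>l\<in>{..<n}. A $$ (i, l) \<otimes> B $$ (l, k)) \<otimes> C $$ (k, j))"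
    using ij A B C
    by (auto simp: UT_mult_entry UT_entry_closed intro!: finsum_cong' finsum_closed)
  also have "\<dots> = (\<Oplus>k\<in>{..<n}. \<Oplus>l\<in>{..<n}. ?t k l)"
    using ij A B C
    by (auto simp: UT_entry_closed intro!: finsum_cong' finsum_closed finsum_ldistr)
  also have "\<dots> = (\<Oplus>l\<in>{..<n}. \<Oplus>k\<in>{..<n}. ?t k l)"
    using ij A B C by (intro finsum_finsum_swap) (auto simp: UT_entry_closed)
  also have "\<dots> = (\<Oplus>l\<in>{..<n}. A $$ (i, l) \<otimes> (\<Oplus>k\<in>{..<n}. B $$ (l, k) \<otimes> C $$ (k, j)))"
    using ij A B C
    by (auto simp: UT_entry_closed finsum_rdistr m_assoc intro!: finsum_cong' finsum_closed)
  also have "\<dots> = (A \<otimes>\<^bsub>UT n\<^esub> (B \<otimes>\<^bsub>UT n\<^esub> C)) $$ (i, j)"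
    using ij A B C
    by (auto simp: UT_mult_entry UT_entry_closed intro!: finsum_cong' finsum_closed)
  finally show "((A \<otimes>\<^bsub>UT n\<^esub> B) \<otimes>\<^bsub>UT n\<^esub> C) $$ (i, j)
      = (A \<otimes>\<^bsub>UT n\<^esub> (B \<otimes>\<^bsub>UT n\<^esub> C)) $$ (i, j)" .
qed (intro UT_mult_closed A B C)+

text \<open>The Kronecker delta on the left leaves one summand, which gives the left unit law; the
  mirror image below gives the right one.\<close>

lemma finsum_delta_left:
  fixes n :: nat
  assumes "i < n" "\<And>k. k < n \<Longrightarrow> f k \<in> carrier R"
  shows "(\<Oplus>k\<in>{..<n}. (if i = k then \<one> else \<zero>) \<otimes> f k) = f i"
proof -
  have "(\<Oplus>k\<in>{..<n}. (if i = k then \<one> else \<zero>) \<otimes> f k) = (\<Oplus>k\<in>{..<n}. if i = k then f k else \<zero>)"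
    using assms by (intro finsum_cong') auto
  also have "\<dots> = f i"
    by (rule finsum_singleton) (use assms in auto)
  finally show ?thesis .
qed

lemma finsum_delta_right:
  fixes n :: nat
  assumes "j < n" "\<And>k. k < n \<Longrightarrow> f k \<in> carrier R"
  shows "(\<Oplus>k\<in>{..<n}. f k \<otimes> (if k = j then \<one> else \<zero>)) = f j"
proof -
  have "(\<Oplus>k\<in>{..<n}. f k \<otimes> (if k = j then \<one> else \<zero>)) = (\<Oplus>k\<in>{..<n}. if j = k then f k else \<zero>)"
    using assms by (intro finsum_cong') auto
  also have "\<dots> = f j"
    by (rule finsum_singleton) (use assms in auto)
  finally show ?thesis .
qed

lemma UT_one_mult:
  assumes A: "A \<in> carrier (UT n)"
  shows "\<one>\<^bsub>UT n\<^esub> \<otimes>\<^bsub>UT n\<^esub> A = A"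
proof (rule UT_eqI)
  fix i j assume ij: "i < n" "j < n"
  have "(\<one>\<^bsub>UT n\<^esub> \<otimes>\<^bsub>UT n\<^esub> A) $$ (i, j)
      = (\<Oplus>k\<in>{..<n}. (if i = k then \<one> else \<zero>) \<otimes> A $$ (k, j))"
    unfolding UT_mult_entry[OF ij]
    using ij A by (intro finsum_cong') (auto simp: UT_one_entry UT_entry_closed)
  then show "(\<one>\<^bsub>UT n\<^esub> \<otimes>\<^bsub>UT n\<^esub> A) $$ (i, j) = A $$ (i, j)"
    using finsum_delta_left[of i n "\<lambda>k. A $$ (k, j)"] ij A by (simp add: UT_entry_closed)
qed (intro UT_mult_closed UT_one_closed A)+

lemma UT_mult_one:
  assumes A: "A \<in> carrier (UT n)"
  shows "A \<otimes>\<^bsub>UT n\<^esub> \<one>\<^bsub>UT n\<^esub> = A"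
proof (rule UT_eqI)
  fix i j assume ij: "i < n" "j < n"
  have "(A \<otimes>\<^bsub>UT n\<^esub> \<one>\<^bsub>UT n\<^esub>) $$ (i, j)
      = (\<Oplus>k\<in>{..<n}. A $$ (i, k) \<otimes> (if k = j then \<one> else \<zero>))"
    unfolding UT_mult_entry[OF ij]
    using ij A by (intro finsum_cong') (auto simp: UT_one_entry UT_entry_closed)
  then show "(A \<otimes>\<^bsub>UT n\<^esub> \<one>\<^bsub>UT n\<^esub>) $$ (i, j) = A $$ (i, j)"
    using finsum_delta_right[of j n "\<lambda>k. A $$ (i, k)"] ij A by (simp add: UT_entry_closed)
qed (intro UT_mult_closed UT_one_closed A)+

lemma UT_uminus_exists:
  assumes A: "A \<in> carrier (UT n)"
  shows "\<exists>B \<in> carrier (UT n). B \<oplus>\<^bsub>UT n\<^esub> A = \<zero>\<^bsub>UT n\<^esub>"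
proof
  let ?B = "mat n n (\<lambda>(i, j). \<ominus> (A $$ (i, j)))"
  show B: "?B \<in> carrier (UT n)"
    using A by (auto simp: UT_carrier_iff)
  show "?B \<oplus>\<^bsub>UT n\<^esub> A = \<zero>\<^bsub>UT n\<^esub>"
    by (rule UT_eqI[OF UT_add_closed[OF B A] UT_zero_closed])
      (use A in \<open>simp add: UT_add_entry UT_zero_entry UT_entry_closed l_neg\<close>)
qed

lemma UT_abelian_group: "abelian_group (UT n)"
proof (rule abelian_groupI)
  fix A B C assume "A \<in> carrier (UT n)" "B \<in> carrier (UT n)" "C \<in> carrier (UT n)"
  then show "(A \<oplus>\<^bsub>UT n\<^esub> B) \<oplus>\<^bsub>UT n\<^esub> C = A \<oplus>\<^bsub>UT n\<^esub> (B \<oplus>\<^bsub>UT n\<^esub> C)"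
    by (intro UT_eqI[of _ n] UT_add_closed) (simp_all add: UT_add_entry UT_entry_closed a_assoc)
next
  fix A B assume "A \<in> carrier (UT n)" "B \<in> carrier (UT n)"
  then show "A \<oplus>\<^bsub>UT n\<^esub> B = B \<oplus>\<^bsub>UT n\<^esub> A"
    by (intro UT_eqI[of _ n] UT_add_closed) (simp_all add: UT_add_entry UT_entry_closed a_comm)
next
  fix A assume "A \<in> carrier (UT n)"
  then show "\<zero>\<^bsub>UT n\<^esub> \<oplus>\<^bsub>UT n\<^esub> A = A"
    by (intro UT_eqI[of _ n] UT_add_closed UT_zero_closed)
      (simp_all add: UT_add_entry UT_zero_entry UT_entry_closed)
qed (auto intro: UT_add_closed UT_zero_closed UT_uminus_exists)

lemma UT_ring: "ring (UT n)"
proof (rule ringI)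
  show "abelian_group (UT n)" by (rule UT_abelian_group)
  show "monoid (UT n)"
    by (rule monoidI)
      (simp_all add: UT_mult_closed UT_one_closed UT_mult_assoc UT_one_mult UT_mult_one)
next
  fix A B C
  assume A: "A \<in> carrier (UT n)" and B: "B \<in> carrier (UT n)" and C: "C \<in> carrier (UT n)"
  note * = A[THEN UT_entry_closed] B[THEN UT_entry_closed] C[THEN UT_entry_closed]
  show "(A \<oplus>\<^bsub>UT n\<^esub> B) \<otimes>\<^bsub>UT n\<^esub> C = A \<otimes>\<^bsub>UT n\<^esub> C \<oplus>\<^bsub>UT n\<^esub> B \<otimes>\<^bsub>UT n\<^esub> C"
  proof (rule UT_eqI)
    fix i j assume ij: "i < n" "j < n"
    have "((A \<oplus>\<^bsub>UT n\<^esub> B) \<otimes>\<^bsub>UT n\<^esub> C) $$ (i, j)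
        = (\<Oplus>k\<in>{..<n}. A $$ (i, k) \<otimes> C $$ (k, j) \<oplus> B $$ (i, k) \<otimes> C $$ (k, j))"
      unfolding UT_mult_entry[OF ij] using ij
      by (intro finsum_cong') (auto simp: UT_add_entry * l_distr)
    also have "\<dots> = (A \<otimes>\<^bsub>UT n\<^esub> C \<oplus>\<^bsub>UT n\<^esub> B \<otimes>\<^bsub>UT n\<^esub> C) $$ (i, j)"
      unfolding UT_add_entry[OF ij] UT_mult_entry[OF ij] using ij
      by (intro finsum_addf) (auto simp: *)
    finally show "((A \<oplus>\<^bsub>UT n\<^esub> B) \<otimes>\<^bsub>UT n\<^esub> C) $$ (i, j)
        = (A \<otimes>\<^bsub>UT n\<^esub> C \<oplus>\<^bsub>UT n\<^esub> B \<otimes>\<^bsub>UT n\<^esub> C) $$ (i, j)" .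
  qed (intro UT_add_closed UT_mult_closed A B C)+
  show "C \<otimes>\<^bsub>UT n\<^esub> (A \<oplus>\<^bsub>UT n\<^esub> B) = C \<otimes>\<^bsub>UT n\<^esub> A \<oplus>\<^bsub>UT n\<^esub> C \<otimes>\<^bsub>UT n\<^esub> B"
  proof (rule UT_eqI)
    fix i j assume ij: "i < n" "j < n"
    have "(C \<otimes>\<^bsub>UT n\<^esub> (A \<oplus>\<^bsub>UT n\<^esub> B)) $$ (i, j)
        = (\<Oplus>k\<in>{..<n}. C $$ (i, k) \<otimes> A $$ (k, j) \<oplus> C $$ (i, k) \<otimes> B $$ (k, j))"
      unfolding UT_mult_entry[OF ij] using ij
      by (intro finsum_cong') (auto simp: UT_add_entry * r_distr)
    also have "\<dots> = (C \<otimes>\<^bsub>UT n\<^esub> A \<oplus>\<^bsub>UT n\<^esub> C \<otimes>\<^bsub>UT n\<^esub> B) $$ (i, j)"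
      unfolding UT_add_entry[OF ij] UT_mult_entry[OF ij] using ij
      by (intro finsum_addf) (auto simp: *)
    finally show "(C \<otimes>\<^bsub>UT n\<^esub> (A \<oplus>\<^bsub>UT n\<^esub> B)) $$ (i, j)
        = (C \<otimes>\<^bsub>UT n\<^esub> A \<oplus>\<^bsub>UT n\<^esub> C \<otimes>\<^bsub>UT n\<^esub> B) $$ (i, j)" .
  qed (intro UT_add_closed UT_mult_closed A B C)+
qed

text \<open>Subtraction in \<open>UT n\<close> goes through the abstract additive inverse, so its
  entries cannot be read off a defining formula. They are found by comparing entries in
  \<open>A = (A - B) + B\<close> and cancelling in \<open>R\<close>.\<close>

lemma UT_minus_entry:
  assumes A: "A \<in> carrier (UT n)" and B: "B \<in> carrier (UT n)" and ij: "i < n" "j < n"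
  shows "(A \<ominus>\<^bsub>UT n\<^esub> B) $$ (i, j) = A $$ (i, j) \<ominus> B $$ (i, j)"
proof -
  interpret T: ring "UT n" by (rule UT_ring)
  have C: "A \<ominus>\<^bsub>UT n\<^esub> B \<in> carrier (UT n)" using A B by simp
  have "A = (A \<ominus>\<^bsub>UT n\<^esub> B) \<oplus>\<^bsub>UT n\<^esub> B"
    using A B by (simp add: T.minus_eq T.a_assoc T.l_neg)
  then have "A $$ (i, j) = (A \<ominus>\<^bsub>UT n\<^esub> B) $$ (i, j) \<oplus> B $$ (i, j)"
    using UT_add_entry[OF ij] by metis
  then show ?thesis
    using UT_entry_closed[OF C ij] UT_entry_closed[OF B ij]
    by (simp add: minus_eq a_assoc r_neg)
qed

subsection \<open>Units of the ring of upper triangular matrices\<close>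

text \<open>In the sum over \<open>k\<close>, triangularity of \<open>A\<close> removes the terms
  with \<open>k < i\<close> and that of \<open>B\<close> those with \<open>k > i\<close>.\<close>

lemma UT_mult_diag:
  assumes A: "A \<in> carrier (UT n)" and B: "B \<in> carrier (UT n)" and i: "i < n"
  shows "(A \<otimes>\<^bsub>UT n\<^esub> B) $$ (i, i) = A $$ (i, i) \<otimes> B $$ (i, i)"
proof -
  have "A $$ (i, k) \<otimes> B $$ (k, i) = (if i = k then A $$ (i, k) \<otimes> B $$ (k, i) else \<zero>)"
    if "k < n" for k
    using that i A B
    by (cases i k rule: linorder_cases) (auto simp: UT_entry_zero UT_entry_closed)
  then have "(A \<otimes>\<^bsub>UT n\<^esub> B) $$ (i, i)
      = (\<Oplus>k\<in>{..<n}. if i = k then A $$ (i, k) \<otimes> B $$ (k, i) else \<zero>)"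
    unfolding UT_mult_entry[OF i i] using i A B
    by (intro finsum_cong') (auto simp: UT_entry_closed)
  also have "\<dots> = A $$ (i, i) \<otimes> B $$ (i, i)"
    using i A B by (intro finsum_singleton) (auto simp: UT_entry_closed)
  finally show ?thesis .
qed

text \<open>Forward substitution for row \<open>i\<close> of a left inverse, carried out on the
  first \<open>m\<close> columns. Since \<open>A\<close> is upper triangular, column
  \<open>j\<close> involves only the unknowns up to \<open>b j\<close>; truncating the sum there
  leaves solved equations intact when a new unknown is added. The vanishing of \<open>b j\<close>
  for \<open>j < i\<close> will make the assembled rows triangular.\<close>

lemma row_solve:
  assumes A: "A \<in> carrier (UT n)" and diag: "\<And>i. i < n \<Longrightarrow> A $$ (i, i) \<in> Units R" and "m \<le> n"
  shows "\<exists>b. (\<forall>j<m. b j \<in> carrier R) \<and> (\<forall>j<m. j < i \<longrightarrow> b j = \<zero>)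
    \<and> (\<forall>j<m. (\<Oplus>k\<in>{..<Suc j}. b k \<otimes> A $$ (k, j)) = (if i = j then \<one> else \<zero>))"
  using \<open>m \<le> n\<close>
proof (induction m)
  case 0
  then show ?case by simp
next
  case (Suc m)
  then obtain b where closed: "\<And>j. j < m \<Longrightarrow> b j \<in> carrier R"
    and zero: "\<And>j. j < m \<Longrightarrow> j < i \<Longrightarrow> b j = \<zero>"
    and eqn: "\<And>j. j < m \<Longrightarrow>
      (\<Oplus>k\<in>{..<Suc j}. b k \<otimes> A $$ (k, j)) = (if i = j then \<one> else \<zero>)"
    by auto
  have m: "m < n" using Suc.prems by simp
  define s where "s = (\<Oplus>k\<in>{..<m}. b k \<otimes> A $$ (k, m))"
  \<comment> \<open>The solution of \<open>s + x * A(m,m) = delta(i,m)\<close>, the equation of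
    column \<open>m\<close>. The inverse stands on the right because the unknowns multiply the
    entries of \<open>A\<close> from the left.\<close>
  define x where "x = ((if i = m then \<one> else \<zero>) \<ominus> s) \<otimes> inv (A $$ (m, m))"
  have entry: "A $$ (k, j) \<in> carrier R" if "k < n" "j < n" for k j
    using that A by (simp add: UT_entry_closed)
  have unit: "A $$ (m, m) \<in> Units R" using diag m by simp
  have s: "s \<in> carrier R"
    unfolding s_def using m closed entry by (auto intro!: finsum_closed)
  have x: "x \<in> carrier R"
    unfolding x_def using s unit by auto
  have closed': "(b(m := x)) j \<in> carrier R" if "j < Suc m" for j
    using that closed x by (auto simp: less_Suc_eq)
  have sum_less: "(\<Oplus>k\<in>{..<l}. (b(m := x)) k \<otimes> A $$ (k, j)) = (\<Oplus>k\<in>{..<l}. b k \<otimes> A $$ (k, j))"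
    if "l \<le> m" "j \<le> m" for l j
    using that m closed entry by (intro finsum_cong') auto
  \<comment> \<open>Left of the diagonal all earlier unknowns vanish and the right-hand side is
    zero, so the new unknown vanishes too.\<close>
  have "x = \<zero>" if "m < i"
  proof -
    have "s = \<zero>"
      unfolding s_def using that zero m entry by (intro add.finprod_one_eqI) auto
    then show ?thesis
      using that unit by (simp add: x_def minus_eq)
  qed
  moreover have "(\<Oplus>k\<in>{..<Suc m}. (b(m := x)) k \<otimes> A $$ (k, m)) = (if i = m then \<one> else \<zero>)"
  proof -
    have "(\<Oplus>k\<in>{..<Suc m}. (b(m := x)) k \<otimes> A $$ (k, m)) = x \<otimes> A $$ (m, m) \<oplus> s"
      unfolding lessThan_Suc s_def sum_less[OF order_refl order_refl, symmetric]
      using m closed x entry by (subst finsum_insert) auto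
    also have "x \<otimes> A $$ (m, m) = (if i = m then \<one> else \<zero>) \<ominus> s"
      unfolding x_def using s unit by (subst m_assoc) auto
    also have "(if i = m then \<one> else \<zero>) \<ominus> s \<oplus> s = (if i = m then \<one> else \<zero>)"
      using s by (simp add: minus_eq a_assoc l_neg)
    finally show ?thesis .
  qed
  moreover have "(\<Oplus>k\<in>{..<Suc j}. (b(m := x)) k \<otimes> A $$ (k, j)) = (if i = j then \<one> else \<zero>)"
    if "j < m" for j
    using that eqn sum_less[of "Suc j" j] by simp
  ultimately have "(\<forall>j<Suc m. j < i \<longrightarrow> (b(m := x)) j = \<zero>)
      \<and> (\<forall>j<Suc m. (\<Oplus>k\<in>{..<Suc j}. (b(m := x)) k \<otimes> A $$ (k, j)) = (if i = j then \<one> else \<zero>))"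
    using zero by (auto simp only: less_Suc_eq fun_upd_apply split: if_splits)
  with closed' show ?case by blast
qed

lemma UT_left_inverse:
  assumes A: "A \<in> carrier (UT n)" and diag: "\<And>i. i < n \<Longrightarrow> A $$ (i, i) \<in> Units R"
  obtains B where "B \<in> carrier (UT n)" "B \<otimes>\<^bsub>UT n\<^esub> A = \<one>\<^bsub>UT n\<^esub>"
proof -
  \<comment> \<open>One solution row is chosen for every index \<open>i\<close> simultaneously, so
    that the rows can be stacked into a matrix.\<close>
  obtain b where b: "\<forall>i. (\<forall>j<n. b i j \<in> carrier R) \<and> (\<forall>j<n. j < i \<longrightarrow> b i j = \<zero>)
    \<and> (\<forall>j<n. (\<Oplus>k\<in>{..<Suc j}. b i k \<otimes> A $$ (k, j)) = (if i = j then \<one> else \<zero>))"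
    using choice[OF allI, OF row_solve[OF A diag order_refl]] by (rule exE)
  have closed: "b i j \<in> carrier R" if "j < n" for i j
    using b that by blast
  have zero: "b i j = \<zero>" if "j < n" "j < i" for i j
    using b that by blast
  have eqn: "(\<Oplus>k\<in>{..<Suc j}. b i k \<otimes> A $$ (k, j)) = (if i = j then \<one> else \<zero>)"
    if "j < n" for i j
    using b that by blast
  let ?B = "mat n n (\<lambda>(i, j). b i j)"
  have B: "?B \<in> carrier (UT n)"
    using closed zero by (auto simp: UT_carrier_iff)
  have "?B \<otimes>\<^bsub>UT n\<^esub> A = \<one>\<^bsub>UT n\<^esub>"
  proof (rule UT_eqI[OF UT_mult_closed[OF B A] UT_one_closed])
    fix i j assume ij: "i < n" "j < n"
    have "(?B \<otimes>\<^bsub>UT n\<^esub> A) $$ (i, j) = (\<Oplus>k\<in>{..<n}. b i k \<otimes> A $$ (k, j))"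
      unfolding UT_mult_entry[OF ij]
      using ij closed A by (intro finsum_cong') (auto simp: UT_entry_closed)
    \<comment> \<open>The terms with \<open>k > j\<close> contain an entry of \<open>A\<close> below
      the diagonal, so the full sum agrees with the truncated one.\<close>
    also have "\<dots> = (\<Oplus>k\<in>{..<Suc j}. b i k \<otimes> A $$ (k, j))"
      using ij closed A
      by (intro add.finprod_mono_neutral_cong_right) (auto simp: UT_entry_closed UT_entry_zero)
    also have "\<dots> = \<one>\<^bsub>UT n\<^esub> $$ (i, j)"
      using ij by (simp add: eqn UT_one_entry)
    finally show "(?B \<otimes>\<^bsub>UT n\<^esub> A) $$ (i, j) = \<one>\<^bsub>UT n\<^esub> $$ (i, j)" .
  qed
  with B show thesis by (rule that)
qed

text \<open>Units have unit diagonals because diagonal entries multiply. Conversely, the left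
  inverse \<open>B\<close> of \<open>A\<close> again has a unit diagonal and so has its own left
  inverse \<open>C\<close>; this makes \<open>B\<close> two-sided.\<close>

lemma UT_Units_iff:
  "A \<in> Units (UT n) \<longleftrightarrow> A \<in> carrier (UT n) \<and> (\<forall>i<n. A $$ (i, i) \<in> Units R)"
proof
  assume "A \<in> Units (UT n)"
  then obtain B where A: "A \<in> carrier (UT n)" and B: "B \<in> carrier (UT n)"
    and AB: "B \<otimes>\<^bsub>UT n\<^esub> A = \<one>\<^bsub>UT n\<^esub>" "A \<otimes>\<^bsub>UT n\<^esub> B = \<one>\<^bsub>UT n\<^esub>"
    by (auto simp: Units_def)
  have "A $$ (i, i) \<in> Units R" if i: "i < n" for i
  proof -
    have "B $$ (i, i) \<otimes> A $$ (i, i) = \<one>" "A $$ (i, i) \<otimes> B $$ (i, i) = \<one>"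
      using UT_mult_diag[OF B A i] UT_mult_diag[OF A B i] i by (simp_all add: AB UT_one_entry)
    then show ?thesis
      using UT_entry_closed[OF A i i] UT_entry_closed[OF B i i] by (auto simp: Units_def)
  qed
  with A show "A \<in> carrier (UT n) \<and> (\<forall>i<n. A $$ (i, i) \<in> Units R)" by blast
next
  interpret T: ring "UT n" by (rule UT_ring)
  assume "A \<in> carrier (UT n) \<and> (\<forall>i<n. A $$ (i, i) \<in> Units R)"
  then have A: "A \<in> carrier (UT n)" and diag: "\<And>i. i < n \<Longrightarrow> A $$ (i, i) \<in> Units R"
    by auto
  obtain B where B: "B \<in> carrier (UT n)" and BA: "B \<otimes>\<^bsub>UT n\<^esub> A = \<one>\<^bsub>UT n\<^esub>"
    using UT_left_inverse[OF A diag] .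
  have "B $$ (i, i) \<in> Units R" if i: "i < n" for i
  proof -
    have "B $$ (i, i) \<otimes> A $$ (i, i) = \<one>"
      using UT_mult_diag[OF B A i] i by (simp add: BA UT_one_entry)
    \<comment> \<open>A one-sided inverse of the unit \<open>A $$ (i, i)\<close> is its two-sided
      inverse, hence itself a unit.\<close>
    then show ?thesis
      using Units_one_side_I(2) UT_entry_closed[OF B i i] diag[OF i] by blast
  qed
  then obtain C where C: "C \<in> carrier (UT n)" and CB: "C \<otimes>\<^bsub>UT n\<^esub> B = \<one>\<^bsub>UT n\<^esub>"
    using UT_left_inverse[OF B] by blast
  \<comment> \<open>Associativity gives \<open>C = C(BA) = (CB)A = A\<close>, so
    \<open>CB = 1\<close> turns into the missing equation \<open>AB = 1\<close>.\<close>
  have "C = A" using T.inv_unique[OF CB BA B C A] by simp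
  with A B BA CB show "A \<in> Units (UT n)" by (auto simp: Units_def)
qed

section \<open>Delta of the triangular ring and transfer of the Delta-U properties\<close>

lemma UT_Delta_iff:
  "A \<in> Delta (UT n) \<longleftrightarrow> A \<in> carrier (UT n) \<and> (\<forall>i<n. A $$ (i, i) \<in> Delta R)"
proof
  assume *: "A \<in> Delta (UT n)"
  have A: "A \<in> carrier (UT n)" using * by (simp add: Delta_def)
  have "A $$ (i, i) \<oplus> u \<in> Units R" if i: "i < n" and u: "u \<in> Units R" for i u
  proof -
    \<comment> \<open>A scalar matrix tests the given unit \<open>u\<close> at every diagonal
      position at once.\<close>
    have "diag_mat_ring R n (\<lambda>_. u) \<in> Units (UT n)"
      using u Units_closed[OF u] by (auto simp: UT_Units_iff intro!: diag_mat_ring_closed)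
    then have "A \<oplus>\<^bsub>UT n\<^esub> diag_mat_ring R n (\<lambda>_. u) \<in> Units (UT n)"
      using * by (simp add: Delta_def)
    then have "(A \<oplus>\<^bsub>UT n\<^esub> diag_mat_ring R n (\<lambda>_. u)) $$ (i, i) \<in> Units R"
      using i unfolding UT_Units_iff by blast
    then show ?thesis
      using i by (simp add: UT_add_entry)
  qed
  with A show "A \<in> carrier (UT n) \<and> (\<forall>i<n. A $$ (i, i) \<in> Delta R)"
    by (auto simp: Delta_def UT_entry_closed)
next
  assume "A \<in> carrier (UT n) \<and> (\<forall>i<n. A $$ (i, i) \<in> Delta R)"
  then show "A \<in> Delta (UT n)"
    by (auto simp: Delta_def UT_Units_iff UT_add_entry UT_add_closed)
qed

text \<open>Units and Delta of \<open>UT n\<close> are both detected on the diagonal, and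
  subtracting the identity matrix subtracts \<open>\<one>\<close> from each diagonal entry.\<close>

lemma UT_delta_U_iff:
  assumes "n \<ge> 1"
  shows "delta_U (UT n) \<longleftrightarrow> delta_U R"
proof -
  interpret T: ring "UT n" by (rule UT_ring)
  show ?thesis
    unfolding delta_U_iff T.delta_U_iff
  proof (intro iffI ballI)
    fix A assume *: "\<forall>u\<in>Units R. u \<ominus> \<one> \<in> Delta R" and "A \<in> Units (UT n)"
    then show "A \<ominus>\<^bsub>UT n\<^esub> \<one>\<^bsub>UT n\<^esub> \<in> Delta (UT n)"
      by (auto simp: UT_Delta_iff UT_Units_iff UT_minus_entry UT_one_entry)
  next
    fix u assume *: "\<forall>A\<in>Units (UT n). A \<ominus>\<^bsub>UT n\<^esub> \<one>\<^bsub>UT n\<^esub> \<in> Delta (UT n)" and u: "u \<in> Units R"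
    let ?A = "diag_mat_ring R n (\<lambda>_. u)"
    have A: "?A \<in> carrier (UT n)" using Units_closed[OF u] by (intro diag_mat_ring_closed)
    then have "?A \<ominus>\<^bsub>UT n\<^esub> \<one>\<^bsub>UT n\<^esub> \<in> Delta (UT n)"
      using * u by (auto simp: UT_Units_iff)
    \<comment> \<open>The corner entry exists because \<open>n \<ge> 1\<close>.\<close>
    then have "(?A \<ominus>\<^bsub>UT n\<^esub> \<one>\<^bsub>UT n\<^esub>) $$ (0, 0) \<in> Delta R"
      using assms by (auto simp: UT_Delta_iff)
    then show "u \<ominus> \<one> \<in> Delta R"
      using assms A by (simp add: UT_minus_entry UT_one_entry)
  qed
qed

lemma weak_delta_U_if_delta_U: "delta_U R \<Longrightarrow> weak_delta_U R"
  by (simp add: delta_U_iff weak_delta_U_iff)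

text \<open>The sign in the weak property is common to all diagonal entries of a matrix. Keeping one
  entry equal to \<open>\<one>\<close> beside \<open>u\<close> thus makes a negative sign
  informative: it puts \<open>\<one> \<oplus> \<one>\<close> into Delta.\<close>

lemma delta_U_if_weak_delta_U_UT:
  assumes "n \<ge> 2" and weak: "weak_delta_U (UT n)"
  shows "delta_U R"
  unfolding delta_U_iff
proof
  interpret T: ring "UT n" by (rule UT_ring)
  fix u assume u: "u \<in> Units R"
  have uc [simp]: "u \<in> carrier R" using u by auto
  \<comment> \<open>Index \<open>1\<close> exists since \<open>n \<ge> 2\<close>, and index
    \<open>0\<close> retains the entry \<open>\<one>\<close>.\<close>
  let ?A = "diag_mat_ring R n (\<lambda>i. if i = 1 then u else \<one>)"
  have n: "0 < n" "1 < n" using assms by auto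
  have A: "?A \<in> carrier (UT n)" by (rule diag_mat_ring_closed) simp
  then have "?A \<in> Units (UT n)" using u by (auto simp: UT_Units_iff)
  then consider "?A \<ominus>\<^bsub>UT n\<^esub> \<one>\<^bsub>UT n\<^esub> \<in> Delta (UT n)" | "?A \<oplus>\<^bsub>UT n\<^esub> \<one>\<^bsub>UT n\<^esub> \<in> Delta (UT n)"
    using weak T.weak_delta_U_iff by blast
  then show "u \<ominus> \<one> \<in> Delta R"
  proof cases
    case 1
    then have "(?A \<ominus>\<^bsub>UT n\<^esub> \<one>\<^bsub>UT n\<^esub>) $$ (1, 1) \<in> Delta R"
      using n by (auto simp: UT_Delta_iff)
    then show ?thesis
      using n A UT_minus_entry[OF A UT_one_closed n(2) n(2)] by (simp add: UT_one_entry)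
  next
    case 2
    then have "(?A \<oplus>\<^bsub>UT n\<^esub> \<one>\<^bsub>UT n\<^esub>) $$ (i, i) \<in> Delta R" if "i < n" for i
      using that by (auto simp: UT_Delta_iff)
    from this[OF n(1)] this[OF n(2)] have "u \<oplus> \<one> \<in> Delta R" "\<one> \<oplus> \<one> \<in> Delta R"
      using n UT_add_entry[OF n(1) n(1), of ?A] UT_add_entry[OF n(2) n(2), of ?A]
      by (simp_all add: UT_one_entry)
    \<comment> \<open>Subtracting \<open>\<one> \<oplus> \<one>\<close> turns the negative sign back
      into the positive one.\<close>
    then have "(u \<oplus> \<one>) \<ominus> (\<one> \<oplus> \<one>) \<in> Delta R" by (rule Delta_minus_closed)
    also have "(u \<oplus> \<one>) \<ominus> (\<one> \<oplus> \<one>) = u \<ominus> \<one>"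
      by (simp add: minus_eq minus_add a_assoc r_neg2)
    finally show ?thesis .
  qed
qed

end

theorem proposition4p1:
  fixes R :: "('a, 'm) ring_scheme"
  assumes "ring R"
  shows "(delta_U R \<longleftrightarrow> (\<forall>n\<ge>1. delta_U (upper_triangular_ring R n)))
       \<and> (delta_U R \<longleftrightarrow> (\<exists>n\<ge>1. delta_U (upper_triangular_ring R n)))
       \<and> (delta_U R \<longleftrightarrow> (\<exists>n\<ge>2. weak_delta_U (upper_triangular_ring R n)))"
proof -
  interpret ring R by fact
  \<comment> \<open>The smallest admissible size serves as witness for the existential over
    \<open>n \<ge> 2\<close>.\<close>
  have "weak_delta_U (UT 2)" if "delta_U R"
    using that UT_delta_U_iff[of 2] ring.weak_delta_U_if_delta_U[OF UT_ring, of 2] by simp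
  then show ?thesis
    using UT_delta_U_iff delta_U_if_weak_delta_U_UT by blast
qed

end
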